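(* For every odd integer $n\geq 3$, $\alpha\bigl(\Theta(Q_{4n})\bigr)=2n$.
   Context: $Q_{4n}=\langle a,b : a^{2n}=1,\ b^2=a^n,\ bab^{-1}=a^{-1}\rangle$ is the dicyclic group of order $4n$. For a finite group $G$, $|g|$ denotes the order of $g\in G$, and the prime-coprime graph $\Theta(G)$ is the simple graph with vertex set $G$ in which two distinct vertices $g,h$ are adjacent if and only if $\gcd(|g|,|h|)$ is either $1$ or a prime. The independence number $\alpha(\Gamma)$ of a graph $\Gamma$ is the maximum cardinality of an independent set of $\Gamma$. *)

theory Defs
  imports "HOL-Computational_Algebra.Primes" "HOL-Algebra.Multiplicative_Group" "Graph_Theory.Graph_Theory"
begin

section \<open>Groups given by generators and relations\<close>

datatype 'x letter = Gen 'x | Inv 'x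

type_synonym 'x word = "'x letter list"

text \<open>
  A presentation is a set \<open>R\<close> of pairs \<open>(u, v)\<close> of words, one for each defining relation
  \<open>u = v\<close>; the generators are all elements of the type \<open>'x\<close>.  The presented group consists of the
  words modulo the least congruence that contains \<open>R\<close> and the free cancellations.
\<close>

inductive pres_eq :: "('x word \<times> 'x word) set \<Rightarrow> 'x word \<Rightarrow> 'x word \<Rightarrow> bool"
  for R where
  rel: "(u, v) \<in> R \<Longrightarrow> pres_eq R u v"
| cancel_right: "pres_eq R [Gen x, Inv x] []"
| cancel_left: "pres_eq R [Inv x, Gen x] []"
| refl: "pres_eq R u u"
| sym: "pres_eq R u v \<Longrightarrow> pres_eq R v u"
| trans: "pres_eq R u v \<Longrightarrow> pres_eq R v w \<Longrightarrow> pres_eq R u w"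
| cong: "pres_eq R u u' \<Longrightarrow> pres_eq R v v' \<Longrightarrow> pres_eq R (u @ v) (u' @ v')"

definition pres_class :: "('x word \<times> 'x word) set \<Rightarrow> 'x word \<Rightarrow> 'x word set" where
  "pres_class R u = {v. pres_eq R u v}"

definition presented_group :: "('x word \<times> 'x word) set \<Rightarrow> 'x word set monoid" where
  "presented_group R =
    \<lparr> carrier = range (pres_class R),
      monoid.mult = (\<lambda>X Y. \<Union>u\<in>X. \<Union>v\<in>Y. pres_class R (u @ v)),
      one = pres_class R [] \<rparr>"

lemma pres_class_eq_iff: "pres_class R u = pres_class R v \<longleftrightarrow> pres_eq R u v"
proof
  assume "pres_class R u = pres_class R v"
  then have "v \<in> pres_class R u" by (simp add: pres_class_def pres_eq.refl)
  then show "pres_eq R u v" by (simp add: pres_class_def)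
next
  assume uv: "pres_eq R u v"
  have "pres_eq R u w \<longleftrightarrow> pres_eq R v w" for w
    using pres_eq.trans[OF uv] pres_eq.trans[OF pres_eq.sym[OF uv]] by iprover
  then show "pres_class R u = pres_class R v" by (simp add: pres_class_def)
qed

lemma presented_group_mult:
  "pres_class R u \<otimes>\<^bsub>presented_group R\<^esub> pres_class R v = pres_class R (u @ v)"
proof -
  have "pres_class R (u' @ v') = pres_class R (u @ v)"
    if "u' \<in> pres_class R u" "v' \<in> pres_class R v" for u' v'
    using that unfolding pres_class_eq_iff
    by (intro pres_eq.cong) (simp_all add: pres_class_def pres_eq.sym)
  moreover have "u \<in> pres_class R u" "v \<in> pres_class R v"
    by (simp_all add: pres_class_def pres_eq.refl)
  ultimately have "(\<Union>u'\<in>pres_class R u. \<Union>v'\<in>pres_class R v. pres_class R (u' @ v')) =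
      pres_class R (u @ v)"
    by blast
  then show ?thesis
    by (simp add: presented_group_def)
qed

fun letter_inv :: "'x letter \<Rightarrow> 'x letter" where
  "letter_inv (Gen x) = Inv x"
| "letter_inv (Inv x) = Gen x"

lemma pres_eq_inv_left: "pres_eq R (rev (map letter_inv u) @ u) []"
proof (induction u)
  case Nil
  show ?case by (simp add: pres_eq.refl)
next
  case (Cons l u)
  have l: "pres_eq R [letter_inv l, l] []"
    by (cases l) (simp_all add: pres_eq.cancel_left pres_eq.cancel_right)
  have "pres_eq R (rev (map letter_inv u) @ ([letter_inv l, l] @ u))
                  (rev (map letter_inv u) @ ([] @ u))"
    by (intro pres_eq.cong pres_eq.refl l)
  then show ?case
    using pres_eq.trans[OF _ Cons.IH] by simp
qed

lemma group_presented_group: "group (presented_group R)"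
proof (rule groupI)
  fix X assume "X \<in> carrier (presented_group R)"
  then obtain u where X: "X = pres_class R u" by (auto simp: presented_group_def)
  show "\<one>\<^bsub>presented_group R\<^esub> \<otimes>\<^bsub>presented_group R\<^esub> X = X"
    using presented_group_mult[of R "[]" u] by (simp add: X) (simp add: presented_group_def)
  show "\<exists>Y\<in>carrier (presented_group R). Y \<otimes>\<^bsub>presented_group R\<^esub> X = \<one>\<^bsub>presented_group R\<^esub>"
  proof
    show "pres_class R (rev (map letter_inv u)) \<otimes>\<^bsub>presented_group R\<^esub> X = \<one>\<^bsub>presented_group R\<^esub>"
      unfolding X presented_group_mult
      by (simp add: presented_group_def pres_class_eq_iff pres_eq_inv_left)
  qed (simp add: presented_group_def)
next
  fix X Y assume "X \<in> carrier (presented_group R)" "Y \<in> carrier (presented_group R)"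
  then obtain u v where "X = pres_class R u" "Y = pres_class R v"
    by (auto simp: presented_group_def)
  then show "X \<otimes>\<^bsub>presented_group R\<^esub> Y \<in> carrier (presented_group R)"
    by (simp add: presented_group_mult) (simp add: presented_group_def)
next
  fix X Y Z
  assume "X \<in> carrier (presented_group R)" "Y \<in> carrier (presented_group R)"
    "Z \<in> carrier (presented_group R)"
  then obtain u v w where "X = pres_class R u" "Y = pres_class R v" "Z = pres_class R w"
    by (auto simp: presented_group_def)
  then show "X \<otimes>\<^bsub>presented_group R\<^esub> Y \<otimes>\<^bsub>presented_group R\<^esub> Z =
      X \<otimes>\<^bsub>presented_group R\<^esub> (Y \<otimes>\<^bsub>presented_group R\<^esub> Z)"
    by (simp add: presented_group_mult)
qed (simp add: presented_group_def)


section \<open>Dicyclic groups\<close>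

datatype dicyclic_gen = A | B

definition dicyclic_relations :: "nat \<Rightarrow> (dicyclic_gen word \<times> dicyclic_gen word) set" where
  "dicyclic_relations n =
    {(replicate (2 * n) (Gen A), []),
     ([Gen B, Gen B], replicate n (Gen A)),
     ([Gen B, Gen A, Inv B], [Inv A])}"

text \<open>The index is \<open>n\<close>, so that \<open>dicyclic_group n\<close> is the group \<open>Q\<close> of order \<open>4 * n\<close>.\<close>

definition dicyclic_group :: "nat \<Rightarrow> dicyclic_gen word set monoid" where
  "dicyclic_group n = presented_group (dicyclic_relations n)"


section \<open>Prime-coprime graphs and the independence number\<close>

text \<open>A simple graph is represented by its symmetric and irreflexive set of arcs.\<close>

definition prime_coprime_graph :: "('a, 'b) monoid_scheme \<Rightarrow> 'a pair_pre_digraph" where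
  "prime_coprime_graph G =
    \<lparr> pverts = carrier G,
      parcs = {(g, h). g \<in> carrier G \<and> h \<in> carrier G \<and> g \<noteq> h \<and>
        (gcd (group.ord G g) (group.ord G h) = 1 \<or>
         prime (gcd (group.ord G g) (group.ord G h)))} \<rparr>"

lemma pair_graph_prime_coprime_graph:
  assumes "finite (carrier G)"
  shows "pair_graph (prime_coprime_graph G)"
proof -
  let ?\<Gamma> = "prime_coprime_graph G"
  have arcs: "(g, h) \<in> parcs ?\<Gamma> \<Longrightarrow>
      g \<in> pverts ?\<Gamma> \<and> h \<in> pverts ?\<Gamma> \<and> g \<noteq> h \<and> (h, g) \<in> parcs ?\<Gamma>" for g h
    by (auto simp: prime_coprime_graph_def gcd.commute)
  have "finite (parcs ?\<Gamma>)"
    by (rule finite_subset[of _ "carrier G \<times> carrier G"])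
      (auto simp: prime_coprime_graph_def assms)
  moreover have "finite (pverts ?\<Gamma>)"
    by (simp add: prime_coprime_graph_def assms)
  moreover have "symmetric (with_proj ?\<Gamma>)"
    unfolding symmetric_def with_proj_simps by (intro symI) (use arcs in simp)
  ultimately show ?thesis
    by unfold_locales (use arcs in \<open>auto simp del: with_proj_simps\<close>)
qed

definition independent_set :: "'a pair_pre_digraph \<Rightarrow> 'a set \<Rightarrow> bool" where
  "independent_set \<Gamma> S \<longleftrightarrow> S \<subseteq> pverts \<Gamma> \<and> (\<forall>u\<in>S. \<forall>v\<in>S. (u, v) \<notin> parcs \<Gamma>)"

text \<open>Meaningful for graphs with finitely many vertices only.\<close>

definition independence_number :: "'a pair_pre_digraph \<Rightarrow> nat" where
  "independence_number \<Gamma> = Max {card S | S. independent_set \<Gamma> S}"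

end

theory Submission
  imports Defs
begin

text \<open>
  The group is the union of \<open>C = {a\<^sup>i}\<close> and \<open>D = {a\<^sup>i b}\<close>.  Every element of \<open>D\<close>
  has order 4, so \<open>D\<close> is independent.  Orders in \<open>C\<close> divide \<open>2 * n\<close>; since \<open>n\<close> is odd, their
  gcd with 4 is 1 or 2, so every vertex of \<open>C\<close> is adjacent to every vertex of \<open>D\<close>.  An independent
  set is therefore contained in \<open>C\<close> or in \<open>D\<close>, each of which has at most \<open>2 * n\<close> elements.  That
  the presentation does not collapse \<open>D\<close> is seen from a monomial representation: with a
  primitive root of unity \<open>\<omega>\<close> of order \<open>2 * n\<close>, the generators act on two copies of the complex
  numbers.
\<close>

section \<open>Groups generated under the dicyclic relations\<close>

locale dicyclic = group G for G (structure) +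
  fixes a b :: 'a and n :: nat
  assumes a_closed [simp]: "a \<in> carrier G" and b_closed [simp]: "b \<in> carrier G"
    and a_pow: "a [^] (2 * n) = \<one>"
    and b_square: "b \<otimes> b = a [^] n"
    and b_conj: "b \<otimes> a \<otimes> inv b = inv a"
begin

lemma b_a: "b \<otimes> a = inv a \<otimes> b"
proof -
  have "b \<otimes> a = b \<otimes> a \<otimes> inv b \<otimes> b" by (simp add: m_assoc)
  then show ?thesis by (simp add: b_conj)
qed

lemma b_a_pow: "b \<otimes> a [^] (i :: nat) = inv (a [^] i) \<otimes> b"
proof (induction i)
  case (Suc i)
  have "b \<otimes> a [^] Suc i = (b \<otimes> a [^] i) \<otimes> a" by (simp add: m_assoc)
  also have "\<dots> = inv (a [^] i) \<otimes> (b \<otimes> a)" by (simp add: Suc m_assoc)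
  also have "\<dots> = (inv (a [^] i) \<otimes> inv a) \<otimes> b" by (simp add: b_a m_assoc)
  also have "inv (a [^] i) \<otimes> inv a = inv (a \<otimes> a [^] i)" by (simp add: inv_mult_group)
  also have "a \<otimes> a [^] i = a [^] Suc i" by (metis a_closed nat_pow_Suc2)
  finally show ?case .
qed simp

lemma pow_mod: "a [^] (i mod (2 * n)) = a [^] (i :: nat)"
proof -
  have "a [^] i = a [^] (2 * n * (i div (2 * n)) + i mod (2 * n))" by simp
  also have "\<dots> = (a [^] (2 * n)) [^] (i div (2 * n)) \<otimes> a [^] (i mod (2 * n))"
    by (simp only: nat_pow_mult[symmetric] nat_pow_pow a_closed)
  finally show ?thesis by (simp add: a_pow)
qed

text \<open>Since \<open>a [^] (2 * n) = \<one>\<close>, inverses are again powers with natural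
  exponents, which keeps normal forms free of negative exponents. Positivity of \<open>n\<close>
  keeps the subtraction from truncating.\<close>

lemma inv_pow:
  assumes "n > 0"
  shows "inv (a [^] i) = a [^] ((2 * n - 1) * i)"
proof (rule inv_equality)
  have "a [^] ((2 * n - 1) * i) \<otimes> a [^] i = a [^] ((2 * n - 1) * i + i)"
    by (simp add: nat_pow_mult)
  also have "(2 * n - 1) * i + i = (2 * n) * i"
    using assms by (cases n) auto
  finally show "a [^] ((2 * n - 1) * i) \<otimes> a [^] i = \<one>"
    using nat_pow_pow[of a "2 * n" i] by (simp add: a_pow)
qed simp_all

text \<open>The set \<open>C\<close> of the overview; \<open>reflections\<close> is
  \<open>D\<close>. The names follow the analogy with dihedral groups.\<close>

definition rotations :: "'a set" where
  "rotations = (\<lambda>i. a [^] i) ` {..<2 * n}"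

definition reflections :: "'a set" where
  "reflections = (\<lambda>i. a [^] i \<otimes> b) ` {..<2 * n}"

lemma rotations_reflections_carrier: "rotations \<subseteq> carrier G" "reflections \<subseteq> carrier G"
  by (auto simp: rotations_def reflections_def)

text \<open>Only upper bounds are possible here: proper quotients of the dicyclic group also satisfy
  the locale assumptions, and in them the listed elements may coincide.\<close>

lemma card_rotations_reflections: "card rotations \<le> 2 * n" "card reflections \<le> 2 * n"
  unfolding rotations_def reflections_def by (metis card_image_le card_lessThan finite_lessThan)+

context
  assumes n_pos: "n > 0"
begin

lemma rotationsI: "a [^] (i :: nat) \<in> rotations"
  unfolding rotations_def by (rule image_eqI[of _ _ "i mod (2 * n)"]) (simp_all add: pow_mod n_pos)

lemma reflectionsI: "a [^] (i :: nat) \<otimes> b \<in> reflections"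
  unfolding reflections_def by (rule image_eqI[of _ _ "i mod (2 * n)"]) (simp_all add: pow_mod n_pos)

text \<open>This lemma and the next three cover left multiplication by each kind of letter;
  induction on words then puts every class into normal form.\<close>

lemma a_mult_closed:
  assumes "x \<in> rotations \<union> reflections"
  shows "a [^] (k :: nat) \<otimes> x \<in> rotations \<union> reflections"
proof -
  have "a [^] k \<otimes> a [^] i \<in> rotations" for i :: nat
    using rotationsI by (simp add: nat_pow_mult)
  moreover have "a [^] k \<otimes> (a [^] i \<otimes> b) \<in> reflections" for i :: nat
    using reflectionsI[of "k + i"] by (simp add: nat_pow_mult[symmetric] m_assoc)
  ultimately show ?thesis
    using assms unfolding rotations_def reflections_def by blast
qed

lemma b_mult_closed:
  assumes "x \<in> rotations \<union> reflections"
  shows "b \<otimes> x \<in> rotations \<union> reflections"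
proof -
  have "b \<otimes> a [^] i \<in> reflections" for i :: nat
    by (simp add: b_a_pow inv_pow n_pos reflectionsI)
  moreover have "b \<otimes> (a [^] i \<otimes> b) \<in> rotations" for i :: nat
  proof -
    have "b \<otimes> (a [^] i \<otimes> b) = (b \<otimes> a [^] i) \<otimes> b" by (simp add: m_assoc)
    also have "\<dots> = inv (a [^] i) \<otimes> (b \<otimes> b)" by (simp add: b_a_pow m_assoc)
    also have "\<dots> = a [^] ((2 * n - 1) * i + n)"
      by (simp add: b_square inv_pow n_pos nat_pow_mult)
    finally show ?thesis by (simp only: rotationsI)
  qed
  ultimately show ?thesis
    using assms unfolding rotations_def reflections_def by blast
qed

lemma inv_a_mult_closed:
  assumes "x \<in> rotations \<union> reflections"
  shows "inv a \<otimes> x \<in> rotations \<union> reflections"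
  using a_mult_closed[OF assms, of "(2 * n - 1) * 1"] inv_pow[OF n_pos, of 1] by simp

lemma inv_b_mult_closed:
  assumes "x \<in> rotations \<union> reflections"
  shows "inv b \<otimes> x \<in> rotations \<union> reflections"
proof -
  have x: "x \<in> carrier G" using assms rotations_reflections_carrier by blast
  have "(a [^] n \<otimes> b) \<otimes> b = a [^] (n + n)" by (simp add: m_assoc b_square nat_pow_mult)
  then have "inv b = a [^] n \<otimes> b"
    using a_pow by (intro inv_equality) (simp_all add: mult_2)
  then have "inv b \<otimes> x = a [^] n \<otimes> (b \<otimes> x)" using x by (simp add: m_assoc)
  then show ?thesis using a_mult_closed[OF b_mult_closed[OF assms]] by simp
qed

end

lemma ord_rotation:
  assumes "x \<in> rotations"
  shows "ord x dvd 2 * n"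
proof -
  obtain i :: nat where x: "x = a [^] i" using assms by (auto simp: rotations_def)
  have "x [^] (2 * n) = (a [^] (2 * n)) [^] i" by (simp add: x nat_pow_pow mult.commute)
  then have "x [^] (2 * n) = \<one>" by (simp add: a_pow)
  then show ?thesis by (subst (asm) pow_eq_id) (simp_all add: x)
qed

text \<open>Moving \<open>b\<close> past \<open>a [^] i\<close> cancels the powers, so
  \<open>x\<close> squares to \<open>a [^] n\<close> and its fourth power is trivial. The second
  assumption rules out orders 1 and 2.\<close>

lemma ord_reflection:
  assumes "x \<in> reflections" and "a [^] n \<noteq> \<one>"
  shows "ord x = 4"
proof -
  obtain i :: nat where x: "x = a [^] i \<otimes> b" using assms by (auto simp: reflections_def)
  have xc: "x \<in> carrier G" by (simp add: x)
  have "x \<otimes> x = a [^] i \<otimes> (b \<otimes> a [^] i) \<otimes> b" by (simp add: x m_assoc)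
  also have "\<dots> = b \<otimes> b" by (simp add: b_a_pow m_assoc[symmetric])
  also have "\<dots> = a [^] n" by (simp add: b_square)
  finally have sq: "x [^] (2 :: nat) = a [^] n" by (simp add: numeral_2_eq_2 xc)
  have "x [^] (4 :: nat) = (x [^] (2 :: nat)) [^] (2 :: nat)" by (simp add: nat_pow_pow xc)
  also have "\<dots> = \<one>" using a_pow by (simp add: sq nat_pow_pow mult.commute)
  finally have "ord x dvd 2 ^ 2" using pow_eq_id[OF xc, of 4] by simp
  then obtain k where k: "k \<le> 2" "ord x = 2 ^ k"
    using divides_primepow_nat[of 2 "ord x" 2] by auto
  have "\<not> ord x dvd 2" using assms(2) sq pow_eq_id[OF xc, of 2] by simp
  moreover have "k = 0 \<or> k = 1 \<or> k = 2" using k(1) by auto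
  ultimately show ?thesis using k(2) by auto
qed

end

text \<open>Meant for \<open>d\<close> the order of a rotation and 4 that of a reflection: for odd
  \<open>n\<close>, the gcd divides \<open>gcd (2 * n) 4 = 2\<close>.\<close>

lemma gcd_4_dvd_twice_odd:
  fixes d n :: nat
  assumes "d dvd 2 * n" "odd n"
  shows "gcd d 4 = 1 \<or> prime (gcd d 4)"
proof -
  have "gcd d (2 * 2) dvd gcd (2 * n) (2 * 2)" using assms(1) by (intro gcd_mono) auto
  also have "gcd (2 * n) (2 * 2) = 2 * gcd n 2" by (rule gcd_mult_distrib_nat[symmetric])
  also have "gcd n 2 = 1" using assms(2) by (simp add: coprime_iff_gcd_eq_1[symmetric])
  finally have "gcd d 4 dvd 2" by simp
  then have "gcd d 4 = 1 \<or> gcd d 4 = 2" by (metis prime_nat_iff two_is_prime_nat)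
  then show ?thesis by auto
qed

section \<open>The monomial representation\<close>

text \<open>
  The pair \<open>(z, False)\<close> with \<open>z = \<omega>\<^sup>i\<close> stands for \<open>a\<^sup>i\<close> and \<open>(z, True)\<close> for \<open>a\<^sup>i b\<close>; letters act
  by left multiplication.  As \<open>inverse 0 = 0\<close>, the relations hold on all pairs.
\<close>

fun letter_act :: "complex \<Rightarrow> dicyclic_gen letter \<Rightarrow> complex \<times> bool \<Rightarrow> complex \<times> bool" where
  "letter_act w (Gen A) (z, e) = (w * z, e)"
| "letter_act w (Inv A) (z, e) = (inverse w * z, e)"
| "letter_act w (Gen B) (z, e) = (if e then - inverse z else inverse z, \<not> e)"
| "letter_act w (Inv B) (z, e) = (if e then inverse z else - inverse z, \<not> e)"

lemma foldr_letter_act_replicate: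
  "foldr (letter_act w) (replicate k (Gen A)) (z, e) = (w ^ k * z, e)"
  by (induction k) simp_all

text \<open>Words that act differently thus lie in different classes. Acting twice by
  \<open>B\<close> negates the first component, so the relation for the square of \<open>B\<close>
  forces \<open>w ^ n = -1\<close>.\<close>

lemma pres_eq_dicyclic_act:
  assumes "pres_eq (dicyclic_relations n) u v" and w: "w ^ n = -1" "w \<noteq> 0"
  shows "foldr (letter_act w) u = foldr (letter_act w) v"
  using assms(1)
proof induction
  case (rel u v)
  have "w ^ (2 * n) = 1" using w(1) by (simp add: power_mult mult.commute[of 2])
  with rel show ?case
    by (intro ext)
      (auto simp: dicyclic_relations_def foldr_letter_act_replicate w split_paired_all
        simp del: foldr_replicate)
next
  case (cancel_right x)
  show ?case by (cases x) (auto simp: fun_eq_iff w)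
next
  case (cancel_left x)
  show ?case by (cases x) (auto simp: fun_eq_iff w)
qed simp_all

section \<open>The presented group as an instance of the locale\<close>

abbreviation dicyclic_class :: "nat \<Rightarrow> dicyclic_gen word \<Rightarrow> dicyclic_gen word set" where
  "dicyclic_class n \<equiv> pres_class (dicyclic_relations n)"

lemma dicyclic_mult:
  "dicyclic_class n u \<otimes>\<^bsub>dicyclic_group n\<^esub> dicyclic_class n v = dicyclic_class n (u @ v)"
  by (simp add: dicyclic_group_def presented_group_mult)

lemma dicyclic_one: "\<one>\<^bsub>dicyclic_group n\<^esub> = dicyclic_class n []"
  by (simp add: dicyclic_group_def presented_group_def)

lemma dicyclic_carrier: "carrier (dicyclic_group n) = range (dicyclic_class n)"
  by (simp add: dicyclic_group_def presented_group_def)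

lemma dicyclic_pow:
  "dicyclic_class n [l] [^]\<^bsub>dicyclic_group n\<^esub> (k :: nat) = dicyclic_class n (replicate k l)"
  by (induction k) (simp_all add: dicyclic_one dicyclic_mult replicate_append_same)

lemma dicyclic_inv: "inv\<^bsub>dicyclic_group n\<^esub> dicyclic_class n [Gen x] = dicyclic_class n [Inv x]"
proof -
  interpret group "dicyclic_group n"
    unfolding dicyclic_group_def by (rule group_presented_group)
  show ?thesis
    by (rule inv_equality)
      (auto simp: dicyclic_mult dicyclic_one dicyclic_carrier pres_class_eq_iff pres_eq.cancel_left)
qed

lemma dicyclic_dicyclic_group:
  "dicyclic (dicyclic_group n) (dicyclic_class n [Gen A]) (dicyclic_class n [Gen B]) n"
proof -
  interpret group "dicyclic_group n"
    unfolding dicyclic_group_def by (rule group_presented_group)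
  have "dicyclic_class n (replicate (2 * n) (Gen A)) = dicyclic_class n []"
    "dicyclic_class n [Gen B, Gen B] = dicyclic_class n (replicate n (Gen A))"
    "dicyclic_class n [Gen B, Gen A, Inv B] = dicyclic_class n [Inv A]"
    unfolding pres_class_eq_iff by (rule pres_eq.rel, simp add: dicyclic_relations_def)+
  then show ?thesis
    by unfold_locales
      (simp_all add: dicyclic_carrier dicyclic_pow dicyclic_inv dicyclic_mult dicyclic_one)
qed

theorem proposition3p17:
  fixes n :: nat
  assumes "odd n" and "n \<ge> 3"
  shows "independence_number (prime_coprime_graph (dicyclic_group n)) = 2 * n"
proof -
  define a b where "a = dicyclic_class n [Gen A]" and "b = dicyclic_class n [Gen B]"
  interpret dicyclic "dicyclic_group n" a b n
    unfolding a_def b_def by (rule dicyclic_dicyclic_group)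
  let ?G = "dicyclic_group n"
  let ?\<Gamma> = "prime_coprime_graph ?G"
  have n: "n > 0" using assms(2) by simp

  \<comment> \<open>A primitive root of unity of order \<open>2 * n\<close>: its \<open>n\<close>-th
    power is \<open>cis pi = -1\<close>, and its first \<open>2 * n\<close> powers are
    distinct.\<close>
  define w where "w = cis (2 * pi / (2 * n))"
  have w_pow: "w ^ k = cis (2 * pi * k / (2 * n))" for k
    by (simp add: w_def DeMoivre mult_ac)
  have w: "w ^ n = -1" "w \<noteq> 0"
    using n by (simp add: w_pow) (simp add: w_def)
  have w_inj: "inj_on (\<lambda>k. w ^ k) {..<2 * n}"
    using bij_betw_roots_unity[of "2 * n"] n by (simp add: w_pow bij_betw_def)
  have act: "foldr (letter_act w) u = foldr (letter_act w) v"
    if "dicyclic_class n u = dicyclic_class n v" for u v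
    using that pres_eq_dicyclic_act[OF _ w] by (simp add: pres_class_eq_iff)
  \<comment> \<open>The word for \<open>a [^] n\<close> sends \<open>(1, False)\<close> to
    \<open>(-1, False)\<close>, while the empty word fixes it.\<close>
  have "a [^]\<^bsub>?G\<^esub> n \<noteq> \<one>\<^bsub>?G\<^esub>"
    using act[of "replicate n (Gen A)" "[]"] foldr_letter_act_replicate[of w n 1 False] w
    by (auto simp: a_def dicyclic_pow dicyclic_one simp del: foldr_replicate)
  then have ord_refl: "ord x = 4" if "x \<in> reflections" for x
    using ord_reflection that by blast
  \<comment> \<open>The word for the \<open>i\<close>-th reflection sends \<open>(1, False)\<close>
    to \<open>(w ^ i, True)\<close>, from which \<open>i\<close> can be recovered.\<close>
  have "inj_on (\<lambda>i. a [^]\<^bsub>?G\<^esub> i \<otimes>\<^bsub>?G\<^esub> b) {..<2 * n}"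
  proof (rule inj_onI)
    fix i j assume ij: "i \<in> {..<2 * n}" "j \<in> {..<2 * n}"
      and "a [^]\<^bsub>?G\<^esub> i \<otimes>\<^bsub>?G\<^esub> b = a [^]\<^bsub>?G\<^esub> j \<otimes>\<^bsub>?G\<^esub> b"
    then have "foldr (letter_act w) (replicate i (Gen A) @ [Gen B]) (1, False) =
        foldr (letter_act w) (replicate j (Gen A) @ [Gen B]) (1, False)"
      by (intro fun_cong[OF act]) (simp add: a_def b_def dicyclic_pow dicyclic_mult)
    then have "w ^ i = w ^ j"
      by (simp add: foldr_letter_act_replicate del: foldr_replicate)
    then show "i = j" using w_inj ij by (auto dest: inj_onD)
  qed
  then have card_refl: "card reflections = 2 * n"
    by (simp add: reflections_def card_image)

  have "dicyclic_class n u \<in> rotations \<union> reflections" for u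
  proof (induction u)
    case Nil
    show ?case using rotationsI[OF n, of 0] by (simp add: dicyclic_one)
  next
    case (Cons l u)
    have step: "dicyclic_class n (l # u) = dicyclic_class n [l] \<otimes>\<^bsub>?G\<^esub> dicyclic_class n u"
      by (simp add: dicyclic_mult)
    show ?case
    proof (cases l)
      case (Gen x)
      then show ?thesis
        using a_mult_closed[OF n Cons.IH, of 1, unfolded nat_pow_eone[OF a_closed]]
          b_mult_closed[OF n Cons.IH]
        unfolding step by (cases x) (simp_all add: a_def b_def)
    next
      case (Inv x)
      then show ?thesis
        using inv_a_mult_closed[OF n Cons.IH] inv_b_mult_closed[OF n Cons.IH]
        unfolding step by (cases x) (simp_all add: a_def b_def dicyclic_inv)
    qed
  qed
  then have carrier: "carrier ?G = rotations \<union> reflections"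
    using rotations_reflections_carrier by (auto simp: dicyclic_carrier)

  have adj: "(x, y) \<in> parcs ?\<Gamma>" if "x \<in> rotations" "y \<in> reflections" for x y
  proof -
    \<comment> \<open>Adjacency also requires distinct vertices; the order 4 of \<open>y\<close>
      cannot be the order of a rotation.\<close>
    have "\<not> 4 dvd 2 * n" using assms(1) by presburger
    then have "x \<noteq> y" using ord_rotation[OF that(1)] ord_refl[OF that(2)] by auto
    then show ?thesis
      using that gcd_4_dvd_twice_odd[OF ord_rotation[OF that(1)] assms(1)]
      by (simp add: prime_coprime_graph_def carrier ord_refl)
  qed
  have "card S \<le> 2 * n" if S: "independent_set ?\<Gamma> S" for S
  proof -
    have "S \<subseteq> rotations \<union> reflections"
      using S by (simp add: independent_set_def prime_coprime_graph_def carrier)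
    moreover have "S \<inter> rotations = {} \<or> S \<inter> reflections = {}"
      using S adj unfolding independent_set_def by blast
    ultimately have "S \<subseteq> rotations \<or> S \<subseteq> reflections" by blast
    moreover have "finite rotations" "finite reflections"
      by (simp_all add: rotations_def reflections_def)
    ultimately show ?thesis
      using card_rotations_reflections by (meson card_mono order.trans)
  qed
  \<comment> \<open>Two reflections have orders with gcd 4, which is neither 1 nor prime.\<close>
  moreover have "\<not> prime (4 :: nat)"
    by (auto simp: prime_nat_iff intro!: exI[of _ 2])
  then have "independent_set ?\<Gamma> reflections"
    using rotations_reflections_carrier
    by (auto simp: independent_set_def prime_coprime_graph_def ord_refl)
  ultimately show ?thesis
    unfolding independence_number_def
    \<comment> \<open>The bound on \<open>card S\<close> also supplies the finiteness needed for
      \<open>Max\<close>.\<close>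
    by (intro Max_eqI) (auto intro!: finite_subset[of _ "{..2 * n}"] card_refl[symmetric])
qed

end
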